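(* Let $0\le r\le n$. The space of matrices of rank $r$ in $M(n,\mathbb C)$ is preserved by Hamiltonian flow in the standard Poisson structure: every integral curve of a Hamiltonian vector field $\theta_f$ starting at a matrix of rank $r$ consists of matrices of rank $r$.
   Context: Let $a_{ij}$, $1\le i,j\le n$, be the coordinate functions on $M(n,\mathbb C)$. The standard Poisson bracket $\{\cdot,\cdot\}_0$ is determined by antisymmetry, the Leibniz rule and $\{a_{ij},a_{ik}\}_0=a_{ij}a_{ik}$ if $j<k$; $\{a_{ij},a_{kj}\}_0=a_{ij}a_{kj}$ if $i<k$; $\{a_{ij},a_{st}\}_0=0$ if $i<s$, $t<j$; $\{a_{ij},a_{st}\}_0=2a_{it}a_{sj}$ if $i<s$, $j<t$. The Hamiltonian vector field of a $C^\infty$-function $f$ is $\theta_f=\sum_{i,j}\frac{\partial f}{\partial a_{ij}}\theta_{ij}$, where $\theta_{ij}=\sum_{s,t}\{a_{ij},a_{st}\}_0\frac{\partial}{\partial a_{st}}$ (holomorphic partial derivatives; the value $\theta_f(a)$ is regarded as an element of $T_aM(n,\mathbb C)=M(n,\mathbb C)$). *)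

theory Defs
  imports "HOL-Analysis.Analysis"
begin

text \<open>
  Complex \<open>n \<times> n\<close> matrices, with rows and columns indexed by a finite linearly ordered type \<open>'n\<close>.
  The linear order plays the role of the order of the indices \<open>1 < \<dots> < n\<close>, which enters the
  definition of the standard Poisson bracket. The coordinate \<open>a\<^sub>i\<^sub>j\<close> of \<open>a\<close> is \<open>a $ i $ j\<close>.
\<close>

type_synonym 'n cmat = "complex^'n^'n"

text \<open>
  \<open>coord_bracket i j s t\<close> is the function \<open>{a\<^sub>i\<^sub>j, a\<^sub>s\<^sub>t}\<^sub>0\<close>. The first three cases are the defining
  relations (with \<open>{a\<^sub>i\<^sub>j, a\<^sub>s\<^sub>t}\<^sub>0 = 0\<close> for \<open>i < s\<close>, \<open>t < j\<close> absorbed in the last case), the next three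
  are their antisymmetric counterparts.
\<close>

definition coord_bracket ::
    "'n::{finite,linorder} \<Rightarrow> 'n \<Rightarrow> 'n \<Rightarrow> 'n \<Rightarrow> 'n cmat \<Rightarrow> complex" where
  "coord_bracket i j s t a =
    (if i = s \<and> j < t then a $ i $ j * a $ i $ t
     else if i < s \<and> j = t then a $ i $ j * a $ s $ j
     else if i < s \<and> j < t then 2 * a $ i $ t * a $ s $ j
     else if i = s \<and> t < j then - (a $ i $ j * a $ i $ t)
     else if s < i \<and> j = t then - (a $ i $ j * a $ s $ j)
     else if s < i \<and> t < j then - (2 * a $ i $ t * a $ s $ j)
     else 0)"

lemma coord_bracket_antisym: "coord_bracket i j s t a = - coord_bracket s t i j a"
  by (cases i s rule: linorder_cases; cases j t rule: linorder_cases)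
    (auto simp: coord_bracket_def mult_ac)

text \<open>The defining relations hold, and together with antisymmetry they determine the bracket.\<close>

lemma coord_bracket_relations:
  "j < k \<Longrightarrow> coord_bracket i j i k a = a $ i $ j * a $ i $ k"
  "i < k \<Longrightarrow> coord_bracket i j k j a = a $ i $ j * a $ k $ j"
  "i < s \<Longrightarrow> t < j \<Longrightarrow> coord_bracket i j s t a = 0"
  "i < s \<Longrightarrow> j < t \<Longrightarrow> coord_bracket i j s t a = 2 * a $ i $ t * a $ s $ j"
  by (auto simp: coord_bracket_def)

lemma coord_bracket_unique:
  fixes B :: "'n::{finite,linorder} \<Rightarrow> 'n \<Rightarrow> 'n \<Rightarrow> 'n \<Rightarrow> 'n cmat \<Rightarrow> complex"
  assumes anti: "\<And>i j s t a. B i j s t a = - B s t i j a"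
    and row: "\<And>i j k a. j < k \<Longrightarrow> B i j i k a = a $ i $ j * a $ i $ k"
    and col: "\<And>i j k a. i < k \<Longrightarrow> B i j k j a = a $ i $ j * a $ k $ j"
    and opp: "\<And>i j s t a. i < s \<Longrightarrow> t < j \<Longrightarrow> B i j s t a = 0"
    and diag: "\<And>i j s t a. i < s \<Longrightarrow> j < t \<Longrightarrow> B i j s t a = 2 * a $ i $ t * a $ s $ j"
  shows "B = coord_bracket"
proof (intro ext)
  fix i j s t :: 'n and a
  have self: "B i j i j a = 0"
    using anti[of i j i j a] by simp
  have flip: "B i j s t a = coord_bracket i j s t a" if "B s t i j a = coord_bracket s t i j a"
    using that anti[of i j s t a] coord_bracket_antisym[of i j s t a] by simp
  consider "i < s" | "s < i" | "i = s" by (rule linorder_cases)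
  then show "B i j s t a = coord_bracket i j s t a"
  proof cases
    case 1
    then show ?thesis
      by (cases j t rule: linorder_cases) (simp_all add: col opp diag coord_bracket_relations)
  next
    case 2
    then have "B s t i j a = coord_bracket s t i j a"
      by (cases j t rule: linorder_cases) (simp_all add: col opp diag coord_bracket_relations)
    then show ?thesis by (rule flip)
  next
    case 3
    consider "j < t" | "t < j" | "j = t" by (rule linorder_cases)
    then show ?thesis
    proof cases
      case 1
      with 3 show ?thesis by (simp add: row coord_bracket_relations)
    next
      case 2
      with 3 have "B s t i j a = coord_bracket s t i j a"
        by (simp add: row coord_bracket_relations)
      then show ?thesis by (rule flip)
    next
      case 3
      with \<open>i = s\<close> show ?thesis using self by (simp add: coord_bracket_def)
    qed
  qed
qed

text \<open>
  \<open>C\<^sup>k\<close> and \<open>C\<^sup>\<infinity>\<close> functions in the real sense; for finite-dimensional \<open>'a\<close> these agree with the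
  usual notions, as all iterated directional derivatives exist and are continuous.
\<close>

primrec Ck :: "nat \<Rightarrow> ('a::real_normed_vector \<Rightarrow> 'b::real_normed_vector) \<Rightarrow> bool" where
  "Ck 0 f \<longleftrightarrow> continuous_on UNIV f"
| "Ck (Suc k) f \<longleftrightarrow> (\<forall>x. f differentiable at x) \<and> (\<forall>v. Ck k (\<lambda>x. frechet_derivative f (at x) v))"

definition smooth :: "('a::real_normed_vector \<Rightarrow> 'b::real_normed_vector) \<Rightarrow> bool" where
  "smooth f \<longleftrightarrow> (\<forall>k. Ck k f)"

text \<open>
  The holomorphic partial derivative
  \<open>\<partial>f/\<partial>a\<^sub>i\<^sub>j = (\<partial>f/\<partial>x\<^sub>i\<^sub>j - \<i> \<partial>f/\<partial>y\<^sub>i\<^sub>j) / 2\<close>, where \<open>a\<^sub>i\<^sub>j = x\<^sub>i\<^sub>j + \<i> y\<^sub>i\<^sub>j\<close>; the Frechet derivative is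
  the real one, and \<open>axis i (axis j c)\<close> is the matrix with entry \<open>c\<close> at \<open>(i, j)\<close> and \<open>0\<close> elsewhere.
\<close>

definition hol_partial ::
    "(('n::finite) cmat \<Rightarrow> complex) \<Rightarrow> 'n \<Rightarrow> 'n \<Rightarrow> 'n cmat \<Rightarrow> complex" where
  "hol_partial f i j a =
    (frechet_derivative f (at a) (axis i (axis j 1))
      - \<i> * frechet_derivative f (at a) (axis i (axis j \<i>))) / 2"

definition theta_coord ::
    "'n::{finite,linorder} \<Rightarrow> 'n \<Rightarrow> 'n cmat \<Rightarrow> 'n cmat" where
  "theta_coord i j a = (\<chi> s t. coord_bracket i j s t a)"

definition hamiltonian_field ::
    "(('n::{finite,linorder}) cmat \<Rightarrow> complex) \<Rightarrow> 'n cmat \<Rightarrow> 'n cmat" where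
  "hamiltonian_field f a =
    (\<chi> s t. \<Sum>i\<in>UNIV. \<Sum>j\<in>UNIV. hol_partial f i j a * theta_coord i j a $ s $ t)"

definition integral_curve_on ::
    "real set \<Rightarrow> ('a::real_normed_vector \<Rightarrow> 'a) \<Rightarrow> (real \<Rightarrow> 'a) \<Rightarrow> bool" where
  "integral_curve_on J X \<gamma> \<longleftrightarrow>
    is_interval J \<and> (\<forall>t\<in>J. (\<gamma> has_vector_derivative X (\<gamma> t)) (at t within J))"

end

theory Submission
  imports Defs
begin

text \<open>
  With \<open>\<epsilon>(i, s) = 1, 0, -1\<close> according to \<open>i < s\<close>, \<open>i = s\<close>, \<open>i > s\<close>, all the defining relations
  of the bracket are instances of the single formula
  \<open>{a\<^sub>i\<^sub>j, a\<^sub>s\<^sub>t} = (\<epsilon>(i, s) + \<epsilon>(j, t)) a\<^sub>i\<^sub>t a\<^sub>s\<^sub>j\<close>.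
  Summing against the partial derivatives of \<open>f\<close>, the \<open>\<epsilon>(i, s)\<close> part becomes a product with the
  right factor \<open>a\<close> and the \<open>\<epsilon>(j, t)\<close> part a product with the left factor \<open>a\<close>, so that
  \<open>\<theta>\<^sub>f(a) = L(a) a + a R(a)\<close> with \<open>L\<close> and \<open>R\<close> continuous in \<open>a\<close> (\<open>hamiltonian_field_eq\<close>).
  Thus \<open>\<theta>\<^sub>f\<close> is tangent to the orbits of \<open>P \<mapsto> M P N\<close> with invertible \<open>M, N\<close>, and these orbits
  are the sets of matrices of constant rank.

  The passage from this infinitesimal statement to an integral curve \<open>\<gamma>\<close> starting at time \<open>a\<close> is
  an estimate of distances. Let \<open>S\<close> be the set of matrices of rank at most \<open>rank (\<gamma> a)\<close>. It is closed, since rank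
  is lower semicontinuous (\<open>closed_rank_le\<close>), and it is stable under multiplication from both
  sides. Over a short time \<open>h\<close> the curve moves by \<open>P \<mapsto> (1 + h L) P (1 + h R)\<close> up to \<open>o(h)\<close>; this
  map preserves \<open>S\<close> and stretches distances by a factor at most \<open>exp (C h)\<close>. Hence the distance
  from \<open>\<gamma>\<close> to \<open>S\<close> grows at most exponentially, and being \<open>0\<close> at the start it stays \<open>0\<close>
  (\<open>matrix_flow_in_closed_set\<close>). So the rank cannot increase along the curve; running time backwards
  shows that it cannot decrease either.
\<close>

section \<open>Rank of products and lower semicontinuity of rank\<close>

lemma rank_matrix_mul_le_right:
  fixes A :: "'a::field^'n^'m" and B :: "'a^'p^'n"
  shows "rank (A ** B) \<le> rank B"
proof -
  have "row i (A ** B) \<in> vec.span (rows B)" for i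
  proof -
    have "row i (A ** B) = (\<Sum>k\<in>UNIV. A $ i $ k *s row k B)"
      by (simp add: vec_eq_iff row_def matrix_matrix_mult_def)
    also have "\<dots> \<in> vec.span (rows B)"
      by (intro vec.span_sum vec.span_scale vec.span_base) (auto simp: rows_def)
    finally show ?thesis .
  qed
  then have "rows (A ** B) \<subseteq> vec.span (rows B)"
    by (auto simp: rows_def)
  then show ?thesis
    unfolding row_rank_def_gen by (rule vec.dim_mono)
qed

lemma rank_matrix_mul_le_left:
  fixes A :: "'a::field^'n^'m" and B :: "'a^'p^'n"
  shows "rank (A ** B) \<le> rank A"
proof -
  have "row i (A ** B) = row i A v* B" for i
    by (simp add: vec_eq_iff row_def matrix_matrix_mult_def vector_matrix_mult_def mult.commute)
  then have "rows (A ** B) = (\<lambda>v. transpose B *v v) ` rows A"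
    by (auto simp: rows_def image_iff)
  then show ?thesis
    unfolding row_rank_def_gen
    by (metis vec.dim_image_le matrix_vector_mul_linear_gen)
qed

text \<open>
  Choose rows of \<open>A\<close> that form a basis of the row space and replace the other rows by vectors that
  complete them to a basis of the whole space. The resulting matrix has nonzero determinant, and this
  persists when the chosen rows are replaced by those of a nearby matrix \<open>A'\<close>. The row space of \<open>A'\<close>
  together with the \<open>n - rank A\<close> added vectors then still spans, which forces
  \<open>rank A' \<ge> rank A\<close>.
\<close>

lemma rank_ge_neighbourhood:
  fixes A :: "'a::{field,real_normed_algebra_1}^'n^'n"
  shows "\<exists>U. open U \<and> A \<in> U \<and> (\<forall>A'\<in>U. rank A \<le> rank A')"
proof -
  obtain B where B: "B \<subseteq> rows A" "vec.independent B" "card B = vec.dim (rows A)"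
    using vec.basis_exists[of "rows A"] by metis
  define C where "C = vec.extend_basis B"
  have BC: "B \<subseteq> C" and C: "vec.independent C" "vec.span C = UNIV"
    unfolding C_def using B(2) vec.extend_basis_superset vec.independent_extend_basis
      vec.span_extend_basis
    by auto
  have finC: "finite C" using C(1) vec.finiteI_independent by blast
  have cardC: "card C = CARD('n)"
    using vec.dim_eq_card_independent[OF C(1)] C(2) by (metis vec.dim_span vec_dim_card)
  have "\<forall>b\<in>B. \<exists>i. row i A = b" using B(1) by (auto simp: rows_def)
  then obtain p where p: "\<And>b. b \<in> B \<Longrightarrow> row (p b) A = b" by metis
  have injp: "inj_on p B" by (metis inj_onI p)
  \<comment> \<open>\<open>I\<close> marks the rows that come from \<open>A\<close>; \<open>g\<close> fills the others with the added vectors.\<close>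
  define I where "I = p ` B"
  have cardI: "card I = card B" by (simp add: I_def card_image injp)
  have finD: "finite (C - B)" using finC by simp
  have "card (-I) = card (C - B)"
    using cardI cardC BC finC by (simp add: Compl_eq_Diff_UNIV card_Diff_subset finite_subset)
  then obtain g where g: "bij_betw g (-I) (C - B)"
    using finD by (meson finite finite_same_card_bij)
  define M :: "'a^'n^'n \<Rightarrow> 'a^'n^'n" where "M = (\<lambda>A'. \<chi> i. if i \<in> I then A' $ i else g i)"
  have rowM: "row i (M A') = (if i \<in> I then row i A' else g i)" for i A'
    by (simp add: row_def M_def vec_eq_iff)
  have det_iff: "det (M A') \<noteq> 0 \<longleftrightarrow> vec.span (rows (M A')) = UNIV" for A'
    by (metis invertible_det_nz invertible_left_inverse matrix_left_invertible_span_rows_gen)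
  define U where "U = {A'. det (M A') \<noteq> 0}"
  have "continuous_on UNIV (\<lambda>A'. det (M A'))"
    unfolding det_def
  proof (intro continuous_on_sum continuous_on_mult continuous_on_const continuous_on_prod)
    fix q and i :: 'n
    show "continuous_on UNIV (\<lambda>A'. M A' $ i $ q i)"
      by (cases "i \<in> I") (auto simp: M_def intro!: continuous_intros)
  qed
  then have "open U"
    unfolding U_def by (intro open_Collect_neq continuous_on_const)
  moreover have "A \<in> U"
  proof -
    have row_in: "row i (M A) \<in> rows (M A)" for i
      by (auto simp: rows_def)
    have "C \<subseteq> rows (M A)"
    proof
      fix c assume c: "c \<in> C"
      show "c \<in> rows (M A)"
      proof (cases "c \<in> B")
        case True
        then have "row (p c) (M A) = c" by (simp add: rowM I_def p)
        then show ?thesis using row_in by metis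
      next
        case False
        with c g have "c \<in> g ` (- I)" by (simp add: bij_betw_def)
        then obtain i where "i \<notin> I" "c = g i" by auto
        then have "row i (M A) = c" by (simp add: rowM)
        then show ?thesis using row_in by metis
      qed
    qed
    then have "vec.span (rows (M A)) = UNIV"
      using C(2) vec.span_mono by blast
    then show ?thesis by (simp add: U_def det_iff)
  qed
  moreover have "rank A \<le> rank A'" if "A' \<in> U" for A'
  proof -
    obtain E where E: "finite E" "rows A' \<subseteq> vec.span E" "card E = vec.dim (rows A')"
      using vec.basis_exists[of "rows A'"] vec.finiteI_independent by metis
    have "rows (M A') \<subseteq> vec.span (E \<union> (C - B))"
    proof -
      have "row i (M A') \<in> vec.span (E \<union> (C - B))" for i
      proof (cases "i \<in> I")
        case True
        then have "row i (M A') \<in> vec.span E" using E(2) by (auto simp: rowM rows_def)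
        then show ?thesis using vec.span_mono[of E "E \<union> (C - B)"] by blast
      next
        case False
        then have "row i (M A') \<in> C - B" using g by (auto simp: rowM bij_betw_def)
        then show ?thesis by (intro vec.span_base) auto
      qed
      then show ?thesis by (auto simp: rows_def)
    qed
    then have "vec.span (rows (M A')) \<subseteq> vec.span (E \<union> (C - B))"
      by (rule vec.span_minimal) (rule vec.subspace_span)
    then have "vec.span (E \<union> (C - B)) = UNIV"
      using that by (auto simp: U_def det_iff)
    then have "CARD('n) = vec.dim (E \<union> (C - B))"
      by (metis vec.dim_span vec_dim_card)
    also have "\<dots> \<le> card (E \<union> (C - B))"
      using E(1) finD by (intro vec.dim_le_card') auto
    also have "\<dots> \<le> card E + card (C - B)" by (rule card_Un_le)
    finally have "CARD('n) \<le> rank A' + (CARD('n) - rank A)"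
      using E(3) B(3) cardC BC finC by (simp add: row_rank_def_gen card_Diff_subset finite_subset)
    moreover have "rank A \<le> CARD('n)"
      using card_mono[OF finC BC] B(3) cardC by (simp add: row_rank_def_gen)
    ultimately show ?thesis by simp
  qed
  ultimately show ?thesis by blast
qed

lemma closed_rank_le:
  "closed {A :: 'a::{field,real_normed_algebra_1}^'n^'n. rank A \<le> r}"
proof -
  have "open (- {A :: 'a^'n^'n. rank A \<le> r})"
  proof (subst open_subopen, intro ballI)
    fix A :: "'a^'n^'n" assume A: "A \<in> - {A. rank A \<le> r}"
    obtain U where "open U" "A \<in> U" "\<forall>A'\<in>U. rank A \<le> rank A'"
      using rank_ge_neighbourhood by blast
    with A show "\<exists>T. open T \<and> A \<in> T \<and> T \<subseteq> - {A. rank A \<le> r}"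
      by (intro exI[of _ U]) fastforce
  qed
  then show ?thesis by (simp add: closed_def)
qed

section \<open>Curves driven by left and right multiplication\<close>

lemma bounded_bilinear_matrix_mult:
  "bounded_bilinear ((**) :: complex^'n^'m \<Rightarrow> complex^'p^'n \<Rightarrow> complex^'p^'m)"
  unfolding bilinear_conv_bounded_bilinear[symmetric] bilinear_def
  by (auto intro!: linearI simp: vec_eq_iff matrix_matrix_mult_def sum.distrib scaleR_sum_right algebra_simps)


text \<open>
  A Gronwall argument for the distance \<open>u\<close> from the curve to \<open>S\<close>. For \<open>P \<in> S\<close> the point
  \<open>(1 + h L) P (1 + h R)\<close> is again in \<open>S\<close>, and comparing it with the position of the curve after
  time \<open>h\<close> bounds the new distance by \<open>exp (2 K c h)\<close> times the old one, with an error \<open>e h\<close>.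
  Differentiability at \<open>x\<close> gives such a bound on every small interval \<open>[s, t]\<close> containing \<open>x\<close>, and
  bisection of \<open>[a, b]\<close> glues these local bounds.
\<close>

lemma matrix_flow_in_closed_set:
  fixes \<gamma> :: "real \<Rightarrow> complex^'n^'n" and L R :: "real \<Rightarrow> complex^'n^'n"
  assumes S: "closed S" "S \<noteq> {}" "\<And>P M N. P \<in> S \<Longrightarrow> M ** P ** N \<in> S"
    and ab: "a \<le> b"
    and der: "\<And>x. a \<le> x \<Longrightarrow> x \<le> b \<Longrightarrow>
      (\<gamma> has_vector_derivative (L x ** \<gamma> x + \<gamma> x ** R x)) (at x within {a..b})"
    and bnd: "\<And>x. a \<le> x \<Longrightarrow> x \<le> b \<Longrightarrow> norm (L x) \<le> K \<and> norm (R x) \<le> K"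
    and start: "\<gamma> a \<in> S"
  shows "\<gamma> b \<in> S"
proof -
  interpret mm: bounded_bilinear "(**) :: complex^'n^'n \<Rightarrow> complex^'n^'n \<Rightarrow> complex^'n^'n"
    by (rule bounded_bilinear_matrix_mult)
  \<comment> \<open>The norm of matrices is submultiplicative up to the constant \<open>c\<close>.\<close>
  obtain c where c: "c > 0" "\<And>(A :: complex^'n^'n) (B :: complex^'n^'n). norm (A ** B) \<le> norm A * norm B * c"
    using mm.pos_bounded by blast
  have K: "K \<ge> 0"
    by (rule order_trans[OF norm_ge_zero conjunct1[OF bnd[OF order_refl ab]]])
  \<comment> \<open>One Euler step of length \<open>h\<close>, in the form that visibly preserves \<open>S\<close>; it agrees with the
    additive Euler step up to a term of order \<open>h\<^sup>2\<close>.\<close>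
  define E where "E = (\<lambda>x h (P :: complex^'n^'n). (mat 1 + h *\<^sub>R L x) ** P ** (mat 1 + h *\<^sub>R R x))"
  have E_expand: "E x h P = P + h *\<^sub>R (L x ** P + P ** R x) + h\<^sup>2 *\<^sub>R (L x ** P ** R x)" for x h P
    by (simp add: E_def mm.add_left mm.add_right mm.scaleR_left mm.scaleR_right
        scaleR_add_right power2_eq_square)
  have E_diff: "E x h P - E x h Q = E x h (P - Q)" for x h P Q
    by (simp add: E_def mm.diff_left mm.diff_right)
  have norm2: "norm (L x ** P) \<le> K * c * norm P" "norm (P ** R x) \<le> K * c * norm P"
    if "a \<le> x" "x \<le> b" for x P
  proof -
    have "norm (L x ** P) \<le> norm (L x) * norm P * c" by (rule c)
    also have "\<dots> \<le> K * norm P * c"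
      using bnd[OF that] c(1) by (intro mult_right_mono) auto
    finally show "norm (L x ** P) \<le> K * c * norm P" by (simp add: mult_ac)
    have "norm (P ** R x) \<le> norm P * norm (R x) * c" by (rule c)
    also have "\<dots> \<le> norm P * K * c"
      using bnd[OF that] c(1) by (intro mult_right_mono mult_left_mono) auto
    finally show "norm (P ** R x) \<le> K * c * norm P" by (simp add: mult_ac)
  qed
  have norm3: "norm (L x ** P ** R x) \<le> (K * c)\<^sup>2 * norm P" if "a \<le> x" "x \<le> b" for x P
  proof -
    have "norm (L x ** P ** R x) \<le> K * c * norm (L x ** P)" by (rule norm2) fact+
    also have "\<dots> \<le> K * c * (K * c * norm P)"
      using norm2[OF that] K c(1) by (intro mult_left_mono) auto
    finally show ?thesis by (simp add: power2_eq_square mult_ac)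
  qed
  have E_norm: "norm (E x h P) \<le> exp (2 * K * c * h) * norm P"
    if "a \<le> x" "x \<le> b" "h \<ge> 0" for x h P
  proof -
    have "norm (L x ** P + P ** R x) \<le> K * c * norm P + K * c * norm P"
      by (intro norm_triangle_mono norm2 that)
    then have "norm (h *\<^sub>R (L x ** P + P ** R x)) \<le> h * (K * c * norm P + K * c * norm P)"
      using that(3) by (simp add: mult_left_mono del: mult_2[symmetric])
    moreover have "norm (h\<^sup>2 *\<^sub>R (L x ** P ** R x)) \<le> h\<^sup>2 * ((K * c)\<^sup>2 * norm P)"
      using norm3[OF that(1,2), of P] by (simp add: mult_left_mono)
    ultimately have "norm (E x h P) \<le> norm P + h * (K * c * norm P + K * c * norm P) + h\<^sup>2 * ((K * c)\<^sup>2 * norm P)"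
      unfolding E_expand by (intro norm_triangle_mono order_refl)
    also have "\<dots> = (1 + K * c * h)\<^sup>2 * norm P"
      by (simp add: power2_eq_square algebra_simps)
    also have "\<dots> \<le> (exp (K * c * h))\<^sup>2 * norm P"
      using K c(1) that(3) by (intro mult_right_mono power_mono exp_ge_add_one_self) auto
    also have "(exp (K * c * h))\<^sup>2 = exp (2 * K * c * h)"
      by (simp add: power2_eq_square flip: exp_add)
    finally show ?thesis .
  qed
  have le_exp_mult: "y \<le> exp (2 * K * c * h) * y" if "h \<ge> 0" "y \<ge> 0" for h y
    using mult_right_mono[of 1 "exp (2 * K * c * h)" y] K c(1) that by simp
  define u where "u = (\<lambda>x. infdist (\<gamma> x) S)"
  have u_step: "u t \<le> exp (2 * K * c * h) * u s + e"
    if x: "a \<le> x" "x \<le> b" "h \<ge> 0" and e: "norm (\<gamma> t - E x h (\<gamma> s)) \<le> e" for x h s t e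
  proof -
    have "exp (- (2 * K * c * h)) * (u t - e) \<le> dist (\<gamma> s) P" if "P \<in> S" for P
    proof -
      have "E x h P \<in> S" unfolding E_def using that by (rule S)
      then have "u t \<le> dist (\<gamma> t) (E x h P)" unfolding u_def by (rule infdist_le)
      also have "\<dots> = norm ((\<gamma> t - E x h (\<gamma> s)) + E x h (\<gamma> s - P))"
        by (simp add: dist_norm flip: E_diff)
      also have "\<dots> \<le> e + exp (2 * K * c * h) * norm (\<gamma> s - P)"
        by (intro norm_triangle_mono e E_norm x)
      finally show ?thesis
        by (simp add: exp_minus field_simps dist_norm)
    qed
    then have "exp (- (2 * K * c * h)) * (u t - e) \<le> u s"
      unfolding u_def using S(2) by (simp add: infdist_notempty cINF_greatest)
    then show ?thesis by (simp add: exp_minus field_simps)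
  qed
  have grow: "u b \<le> exp (2 * K * c * (b - a)) * (u a + e * (b - a))" if e: "e > 0" for e
  proof -
    \<comment> \<open>This form of the estimate is transitive in \<open>s \<le> t\<close>, so it passes from small intervals to
      large ones.\<close>
    define P where "P = (\<lambda>s t. a \<le> s \<and> t \<le> b \<longrightarrow>
      u t \<le> exp (2 * K * c * (t - s)) * (u s + e * (t - s)))"
    have "P a b"
      using ab
    proof (induction rule: Bolzano)
      case (trans r s t)
      show ?case
        unfolding P_def
      proof
        assume bd: "a \<le> r \<and> t \<le> b"
        have 1: "u t \<le> exp (2 * K * c * (t - s)) * (u s + e * (t - s))"
          and 2: "u s \<le> exp (2 * K * c * (s - r)) * (u r + e * (s - r))"
          using trans bd by (auto simp: P_def)
        have "e * (t - s) \<le> exp (2 * K * c * (s - r)) * (e * (t - s))"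
          using e trans by (intro le_exp_mult) auto
        with 2 have "u s + e * (t - s) \<le> exp (2 * K * c * (s - r)) * (u r + e * (t - r))"
          by (simp add: algebra_simps)
        then have "exp (2 * K * c * (t - s)) * (u s + e * (t - s))
            \<le> exp (2 * K * c * (t - s)) * (exp (2 * K * c * (s - r)) * (u r + e * (t - r)))"
          by (intro mult_left_mono) auto
        also have "\<dots> = exp (2 * K * c * (t - r)) * (u r + e * (t - r))"
        proof -
          have "2 * K * c * (t - r) = 2 * K * c * (t - s) + 2 * K * c * (s - r)"
            by (simp add: algebra_simps)
          then show ?thesis by (simp only: exp_add mult.assoc)
        qed
        finally show "u t \<le> exp (2 * K * c * (t - r)) * (u r + e * (t - r))"
          using 1 by linarith
      qed
    next
      case (local x)
      define D where "D = (\<lambda>Q. L x ** Q + Q ** R x)"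
      \<comment> \<open>The error \<open>e h\<close> has three parts: the derivative at \<open>x\<close>, the change of the field between
        \<open>\<gamma> x\<close> and \<open>\<gamma> s\<close>, and the quadratic term of the Euler step.\<close>
      define e3 where "e3 = e / 3"
      have e3: "e3 > 0" using e by (simp add: e3_def)
      have "(\<gamma> has_derivative (\<lambda>h. h *\<^sub>R D (\<gamma> x))) (at x within {a..b})"
        using der[OF local] by (simp add: has_vector_derivative_def D_def)
      then obtain d1 where d1: "d1 > 0"
        "\<And>y. y \<in> {a..b} \<Longrightarrow> norm (y - x) < d1 \<Longrightarrow>
          norm (\<gamma> y - \<gamma> x - (y - x) *\<^sub>R D (\<gamma> x)) \<le> e3 * norm (y - x)"
        unfolding has_derivative_within_alt using e3 by blast
      \<comment> \<open>\<open>m\<close> dominates the constants of the last two parts; the final \<open>1\<close> makes it positive.\<close>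
      define m where "m = 2 * (K * c) + (K * c)\<^sup>2 * (norm (\<gamma> x) + 1) + 1"
      have m: "m > 0" "(K * c)\<^sup>2 * (norm (\<gamma> x) + 1) \<le> m" "2 * (K * c) \<le> m"
        using K c(1) by (auto simp: m_def field_simps add_pos_nonneg intro!: add_nonneg_pos)
      have "continuous (at x within {a..b}) \<gamma>"
        using der[OF local] by (rule has_vector_derivative_continuous)
      moreover have "min 1 (e3 / m) > 0" using e3 m(1) by simp
      ultimately obtain d2 where d2: "d2 > 0"
        "\<And>y. y \<in> {a..b} \<Longrightarrow> dist y x < d2 \<Longrightarrow> dist (\<gamma> y) (\<gamma> x) < min 1 (e3 / m)"
        unfolding continuous_within_eps_delta by blast
      define d where "d = Min {d1, d2, e3 / m}"
      have d: "d > 0" "d \<le> d1" "d \<le> d2" "d \<le> e3 / m"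
        using d1 d2 e3 m(1) by (auto simp: d_def)
      have "P s t" if st: "s \<le> x \<and> x \<le> t \<and> t - s < d" for s t
        unfolding P_def
      proof
        assume bd: "a \<le> s \<and> t \<le> b"
        define h where "h = t - s"
        have h: "h \<ge> 0" "h < d" using st by (auto simp: h_def)
        have near: "norm (\<gamma> s - \<gamma> x) < 1" "norm (\<gamma> s - \<gamma> x) < e3 / m"
          using d2(2)[of s] bd st d by (auto simp: dist_norm)
        \<comment> \<open>As \<open>s \<le> x \<le> t\<close>, the errors \<open>\<bar>t - x\<bar>\<close> and \<open>\<bar>s - x\<bar>\<close> add up to exactly \<open>h\<close>.\<close>
        have "norm ((\<gamma> t - \<gamma> x - (t - x) *\<^sub>R D (\<gamma> x)) - (\<gamma> s - \<gamma> x - (s - x) *\<^sub>R D (\<gamma> x)))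
            \<le> e3 * norm (t - x) + e3 * norm (s - x)"
          using bd st d by (intro norm_triangle_le_diff add_mono d1(2)) auto
        then have n1: "norm (\<gamma> t - \<gamma> s - h *\<^sub>R D (\<gamma> x)) \<le> e3 * h"
          using st by (simp add: h_def algebra_simps)
        have "norm (D (\<gamma> x) - D (\<gamma> s)) = norm (L x ** (\<gamma> s - \<gamma> x) + (\<gamma> s - \<gamma> x) ** R x)"
          by (simp add: D_def mm.diff_left mm.diff_right norm_minus_commute algebra_simps)
        also have "\<dots> \<le> K * c * norm (\<gamma> s - \<gamma> x) + K * c * norm (\<gamma> s - \<gamma> x)"
          by (intro norm_triangle_mono norm2 local)
        also have "\<dots> = 2 * (K * c) * norm (\<gamma> s - \<gamma> x)" by simp
        also have "\<dots> \<le> m * (e3 / m)"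
          using near K c(1) m by (intro mult_mono) auto
        finally have n2: "norm (D (\<gamma> x) - D (\<gamma> s)) \<le> e3" using m(1) by simp
        have "norm (\<gamma> s) \<le> norm (\<gamma> x) + 1"
          using near(1) norm_triangle_sub[of "\<gamma> s" "\<gamma> x"] by linarith
        then have "norm (L x ** \<gamma> s ** R x) \<le> (K * c)\<^sup>2 * (norm (\<gamma> x) + 1)"
          using norm3[OF local, of "\<gamma> s"] by (meson mult_left_mono order_trans zero_le_power2)
        then have "h * norm (L x ** \<gamma> s ** R x) \<le> (e3 / m) * m"
          using h d(4) m e3 by (intro mult_mono) auto
        then have n3: "h * norm (L x ** \<gamma> s ** R x) \<le> e3" using m(1) by simp
        have "\<gamma> t - E x h (\<gamma> s) = (\<gamma> t - \<gamma> s - h *\<^sub>R D (\<gamma> x))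
            + h *\<^sub>R (D (\<gamma> x) - D (\<gamma> s)) - h *\<^sub>R (h *\<^sub>R (L x ** \<gamma> s ** R x))"
          by (simp add: E_expand D_def algebra_simps power2_eq_square)
        also have "norm \<dots> \<le> e3 * h + h * e3 + h * e3"
        proof -
          have "norm (h *\<^sub>R (D (\<gamma> x) - D (\<gamma> s))) \<le> h * e3"
            using mult_left_mono[OF n2 h(1)] h(1) by simp
          moreover have "norm (h *\<^sub>R (h *\<^sub>R (L x ** \<gamma> s ** R x))) \<le> h * e3"
            using mult_left_mono[OF n3 h(1)] h(1) by simp
          ultimately show ?thesis
            using n1 by (meson add_mono norm_triangle_le_diff norm_triangle_mono)
        qed
        also have "\<dots> = e * h" by (simp add: e3_def)
        finally have "u t \<le> exp (2 * K * c * h) * u s + e * h"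
          by (intro u_step[OF local h(1)])
        also have "e * h \<le> exp (2 * K * c * h) * (e * h)"
          using e h(1) by (intro le_exp_mult) auto
        finally show "u t \<le> exp (2 * K * c * (t - s)) * (u s + e * (t - s))"
          by (simp add: h_def algebra_simps)
      qed
      then show ?case using d(1) by blast
    qed
    then show ?thesis by (simp add: P_def)
  qed
  have "u a = 0" using start by (simp add: u_def)
  have "u b \<le> 0"
  proof (rule field_le_epsilon)
    fix e :: real assume e: "e > 0"
    \<comment> \<open>The summand \<open>1\<close> keeps \<open>w\<close> positive when \<open>a = b\<close>.\<close>
    define w where "w = exp (2 * K * c * (b - a)) * (b - a) + 1"
    have w: "w > 0" using ab by (auto simp: w_def intro!: add_nonneg_pos)
    have "u b \<le> (e / w) * (exp (2 * K * c * (b - a)) * (b - a))"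
      using grow[of "e / w"] e w \<open>u a = 0\<close> by (simp add: mult_ac)
    also have "\<dots> \<le> (e / w) * w"
      using e w by (intro mult_left_mono) (auto simp: w_def)
    finally show "u b \<le> 0 + e" using w by simp
  qed
  then have "infdist (\<gamma> b) S = 0"
    using infdist_nonneg[of "\<gamma> b" S] by (simp add: u_def)
  then show ?thesis
    using S(1,2) by (simp add: in_closed_iff_infdist_zero)
qed

text \<open>
  Apply the previous lemma to the set of matrices of rank at most \<open>rank (\<gamma> a)\<close>; the bounds on the
  coefficients come from compactness of the image of the curve.
\<close>

lemma rank_le_along_matrix_flow:
  fixes \<gamma> :: "real \<Rightarrow> complex^'n^'n" and L R :: "complex^'n^'n \<Rightarrow> complex^'n^'n"
  assumes L: "continuous_on UNIV L" and R: "continuous_on UNIV R" and ab: "a \<le> b"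
    and der: "\<And>x. a \<le> x \<Longrightarrow> x \<le> b \<Longrightarrow>
      (\<gamma> has_vector_derivative (L (\<gamma> x) ** \<gamma> x + \<gamma> x ** R (\<gamma> x))) (at x within {a..b})"
  shows "rank (\<gamma> b) \<le> rank (\<gamma> a)"
proof -
  have "continuous_on {a..b} \<gamma>"
    using der has_vector_derivative_continuous
    by (force simp: continuous_on_eq_continuous_within)
  then have "compact (\<gamma> ` {a..b})"
    by (intro compact_continuous_image) auto
  then have "compact (L ` \<gamma> ` {a..b})" "compact (R ` \<gamma> ` {a..b})"
    using L R by (auto intro!: compact_continuous_image intro: continuous_on_subset)
  then obtain K1 K2 where "\<forall>x\<in>L ` \<gamma> ` {a..b}. norm x \<le> K1" "\<forall>x\<in>R ` \<gamma> ` {a..b}. norm x \<le> K2"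
    by (meson bounded_iff compact_imp_bounded)
  then have bnd: "norm (L (\<gamma> x)) \<le> max K1 K2 \<and> norm (R (\<gamma> x)) \<le> max K1 K2"
    if "a \<le> x" "x \<le> b" for x
    using that by (auto simp: le_max_iff_disj)
  have "\<gamma> b \<in> {A. rank A \<le> rank (\<gamma> a)}"
  proof (rule matrix_flow_in_closed_set[OF closed_rank_le _ _ ab der bnd])
    show "{A :: complex^'n^'n. rank A \<le> rank (\<gamma> a)} \<noteq> {}" by auto
    show "M ** P ** N \<in> {A. rank A \<le> rank (\<gamma> a)}"
      if "P \<in> {A. rank A \<le> rank (\<gamma> a)}" for M P N :: "complex^'n^'n"
      using that rank_matrix_mul_le_left[of "M ** P" N] rank_matrix_mul_le_right[of M P] by simp
  qed auto
  then show ?thesis by simp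
qed

text \<open>
  The reversed curve \<open>x \<mapsto> \<gamma> (- x)\<close> satisfies an equation of the same kind, with coefficients \<open>- L\<close>
  and \<open>- R\<close>, so the one-sided inequality applies in both directions of time.
\<close>

lemma rank_constant_along_matrix_flow:
  fixes \<gamma> :: "real \<Rightarrow> complex^'n^'n" and L R :: "complex^'n^'n \<Rightarrow> complex^'n^'n"
  assumes J: "is_interval J" and L: "continuous_on UNIV L" and R: "continuous_on UNIV R"
    and der: "\<And>x. x \<in> J \<Longrightarrow>
      (\<gamma> has_vector_derivative (L (\<gamma> x) ** \<gamma> x + \<gamma> x ** R (\<gamma> x))) (at x within J)"
    and st: "s \<in> J" "t \<in> J"
  shows "rank (\<gamma> s) = rank (\<gamma> t)"
proof -
  have sub: "{s..t} \<subseteq> J" if "s \<in> J" "t \<in> J" for s t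
    using J that unfolding is_interval_1 by (meson atLeastAtMost_iff subsetI)
  have fwd: "rank (\<gamma> t) \<le> rank (\<gamma> s)" if "s \<in> J" "t \<in> J" "s \<le> t" for s t
    using L R \<open>s \<le> t\<close>
  proof (rule rank_le_along_matrix_flow)
    fix x assume "s \<le> x" "x \<le> t"
    then show "(\<gamma> has_vector_derivative (L (\<gamma> x) ** \<gamma> x + \<gamma> x ** R (\<gamma> x))) (at x within {s..t})"
      using sub[OF that(1,2)] by (intro has_vector_derivative_within_subset[OF der]) auto
  qed
  have bwd: "rank (\<gamma> s) \<le> rank (\<gamma> t)" if "s \<in> J" "t \<in> J" "s \<le> t" for s t
  proof -
    have "rank ((\<gamma> \<circ> uminus) (- s)) \<le> rank ((\<gamma> \<circ> uminus) (- t))"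
    proof (rule rank_le_along_matrix_flow)
      show "continuous_on UNIV (\<lambda>a. - L a)" "continuous_on UNIV (\<lambda>a. - R a)"
        using L R by (auto intro: continuous_on_minus)
      show "- t \<le> - s" using that by simp
      fix x assume x: "- t \<le> x" "x \<le> - s"
      interpret mm: bounded_bilinear "(**) :: complex^'n^'n \<Rightarrow> complex^'n^'n \<Rightarrow> complex^'n^'n"
        by (rule bounded_bilinear_matrix_mult)
      have "(\<gamma> has_vector_derivative (L (\<gamma> (- x)) ** \<gamma> (- x) + \<gamma> (- x) ** R (\<gamma> (- x))))
          (at (- x) within uminus ` {- t..- s})"
        using sub[OF that(1,2)] x by (intro has_vector_derivative_within_subset[OF der]) auto
      then have "((\<gamma> \<circ> uminus) has_vector_derivative
          (- 1) *\<^sub>R (L (\<gamma> (- x)) ** \<gamma> (- x) + \<gamma> (- x) ** R (\<gamma> (- x)))) (at x within {- t..- s})"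
        by (intro vector_diff_chain_within) (auto intro!: derivative_eq_intros)
      then show "((\<gamma> \<circ> uminus) has_vector_derivative
          (- L ((\<gamma> \<circ> uminus) x) ** (\<gamma> \<circ> uminus) x + (\<gamma> \<circ> uminus) x ** - R ((\<gamma> \<circ> uminus) x)))
          (at x within {- t..- s})"
        by (simp add: mm.minus_left mm.minus_right)
    qed
    then show ?thesis by simp
  qed
  show ?thesis
    using fwd bwd st by (metis antisym linear)
qed

section \<open>The Hamiltonian field as a sum of two multiplications\<close>

text \<open>
  The sign \<open>\<epsilon>(i, s)\<close> of the introduction, as a complex number.
\<close>

definition index_sign :: "'n::linorder \<Rightarrow> 'n \<Rightarrow> complex" where
  "index_sign i s = (if i < s then 1 else if s < i then -1 else 0)"

lemma coord_bracket_eq: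
  "coord_bracket i j s t a = (index_sign i s + index_sign j t) * (a $ i $ t * a $ s $ j)"
  by (auto simp: coord_bracket_def index_sign_def)

definition left_factor :: "('n::{finite,linorder} cmat \<Rightarrow> complex) \<Rightarrow> 'n cmat \<Rightarrow> 'n cmat" where
  "left_factor f a = (\<chi> s i. \<Sum>j\<in>UNIV. hol_partial f i j a * index_sign i s * a $ s $ j)"

definition right_factor :: "('n::{finite,linorder} cmat \<Rightarrow> complex) \<Rightarrow> 'n cmat \<Rightarrow> 'n cmat" where
  "right_factor f a = (\<chi> j t. \<Sum>i\<in>UNIV. hol_partial f i j a * index_sign j t * a $ i $ t)"

text \<open>
  In the coefficient \<open>a\<^sub>i\<^sub>t a\<^sub>s\<^sub>j\<close> the sum over \<open>j\<close> can be carried out first in the term with sign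
  \<open>\<epsilon>(i, s)\<close>, leaving a matrix product over \<open>i\<close>; in the term with sign \<open>\<epsilon>(j, t)\<close> the roles of \<open>i\<close>
  and \<open>j\<close> are exchanged.
\<close>

lemma hamiltonian_field_eq:
  "hamiltonian_field f a = left_factor f a ** a + a ** right_factor f a"
proof -
  have "(\<Sum>i\<in>UNIV. \<Sum>j\<in>UNIV. hol_partial f i j a * coord_bracket i j s t a) =
      (\<Sum>i\<in>UNIV. (\<Sum>j\<in>UNIV. hol_partial f i j a * index_sign i s * a $ s $ j) * a $ i $ t) +
      (\<Sum>j\<in>UNIV. a $ s $ j * (\<Sum>i\<in>UNIV. hol_partial f i j a * index_sign j t * a $ i $ t))" for s t
    unfolding sum_distrib_left sum_distrib_right
    by (subst (3) sum.swap)
      (simp add: coord_bracket_eq sum.distrib[symmetric] algebra_simps)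
  then show ?thesis
    by (simp add: hamiltonian_field_def theta_coord_def left_factor_def right_factor_def
        matrix_matrix_mult_def vec_eq_iff)
qed

lemma continuous_hol_partial:
  assumes "smooth f"
  shows "continuous_on UNIV (hol_partial f i j)"
proof -
  have "Ck (Suc 0) f" using assms by (simp add: smooth_def)
  then have "continuous_on UNIV (\<lambda>a. frechet_derivative f (at a) v)" for v
    by simp
  then show ?thesis
    unfolding hol_partial_def by (intro continuous_intros) auto
qed

lemma continuous_factors:
  assumes "smooth f"
  shows "continuous_on UNIV (left_factor f)" "continuous_on UNIV (right_factor f)"
  unfolding left_factor_def right_factor_def
  by (intro continuous_intros continuous_hol_partial assms)+

theorem corollary12p6:
  fixes f :: "('n::{finite,linorder}) cmat \<Rightarrow> complex"
    and \<gamma> :: "real \<Rightarrow> 'n cmat"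
    and J :: "real set"
    and r :: nat
  assumes "r \<le> CARD('n)"
    and "smooth f"
    and "integral_curve_on J (hamiltonian_field f) \<gamma>"
    and "0 \<in> J"
    and "rank (\<gamma> 0) = r"
  shows "\<forall>t\<in>J. rank (\<gamma> t) = r"
proof
  fix t assume "t \<in> J"
  have "rank (\<gamma> 0) = rank (\<gamma> t)"
  proof (rule rank_constant_along_matrix_flow[OF _ continuous_factors[OF assms(2)]])
    show "is_interval J" using assms(3) by (simp add: integral_curve_on_def)
    show "(\<gamma> has_vector_derivative (left_factor f (\<gamma> x) ** \<gamma> x + \<gamma> x ** right_factor f (\<gamma> x)))
        (at x within J)" if "x \<in> J" for x
      using assms(3) that by (simp add: integral_curve_on_def flip: hamiltonian_field_eq)
  qed fact+
  then show "rank (\<gamma> t) = r" using assms(5) by simp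
qed

end
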